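(* Let $G$ be a graph with $\chi'(G)=\Delta(G)\leq 3$. If no component of $G$ is an odd cycle, then $G$ is interval colorable.
   Context: Graphs are finite, undirected, may have multiple edges, and have no loops. $\Delta(G)$ is the maximum degree and $\chi'(G)$ the chromatic index (the minimum number of colors in a proper edge coloring) of $G$. For a positive integer $t$, an interval $t$-coloring of $G$ is a proper edge coloring of $G$ with colors $1,2,\dots,t$ such that for every vertex the colors of the edges incident to it form an interval of integers. A graph is interval colorable if it has an interval $t$-coloring for some positive integer $t$. *)

theory Defs
  imports Main
begin

text \<open>
  A multigraph has a vertex set, a set of edge names, and a map sending each edge to the set of
  its two ends. Parallel edges are distinct names with the same ends; \<open>card (ends e) = 2\<close>
  excludes loops. The values of \<open>ends\<close> outside \<open>E\<close> are irrelevant, so a subgraph is given by a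
  pair of subsets, with the same map \<open>ends\<close>.
\<close>

locale multigraph =
  fixes V :: "'v set" and E :: "'e set" and ends :: "'e \<Rightarrow> 'v set"
  assumes finite_V: "finite V"
    and finite_E: "finite E"
    and ends_subset: "e \<in> E \<Longrightarrow> ends e \<subseteq> V"
    and card_ends: "e \<in> E \<Longrightarrow> card (ends e) = 2"

definition incident_edges :: "'e set \<Rightarrow> ('e \<Rightarrow> 'v set) \<Rightarrow> 'v \<Rightarrow> 'e set" where
  "incident_edges E ends v = {e \<in> E. v \<in> ends e}"

definition degree :: "'e set \<Rightarrow> ('e \<Rightarrow> 'v set) \<Rightarrow> 'v \<Rightarrow> nat" where
  "degree E ends v = card (incident_edges E ends v)"

text \<open>Inserting 0 only matters for the graph without vertices.\<close>

definition max_degree :: "'v set \<Rightarrow> 'e set \<Rightarrow> ('e \<Rightarrow> 'v set) \<Rightarrow> nat" where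
  "max_degree V E ends = Max (insert 0 (degree E ends ` V))"

definition proper_edge_coloring :: "'e set \<Rightarrow> ('e \<Rightarrow> 'v set) \<Rightarrow> ('e \<Rightarrow> nat) \<Rightarrow> bool" where
  "proper_edge_coloring E ends c \<longleftrightarrow>
     (\<forall>e\<in>E. \<forall>f\<in>E. e \<noteq> f \<and> ends e \<inter> ends f \<noteq> {} \<longrightarrow> c e \<noteq> c f)"

definition chromatic_index :: "'e set \<Rightarrow> ('e \<Rightarrow> 'v set) \<Rightarrow> nat" where
  "chromatic_index E ends =
     (LEAST k. \<exists>c. proper_edge_coloring E ends c \<and> c ` E \<subseteq> {1..k})"

text \<open>
  The colors are taken from \<open>{1..t}\<close>, but not every one of them has to occur. The interval at an
  isolated vertex is empty.
\<close>

definition interval_coloring ::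
  "'v set \<Rightarrow> 'e set \<Rightarrow> ('e \<Rightarrow> 'v set) \<Rightarrow> nat \<Rightarrow> ('e \<Rightarrow> nat) \<Rightarrow> bool" where
  "interval_coloring V E ends t c \<longleftrightarrow>
     proper_edge_coloring E ends c \<and> c ` E \<subseteq> {1..t} \<and>
     (\<forall>v\<in>V. \<exists>a b. c ` incident_edges E ends v = {a..b})"

definition interval_colorable :: "'v set \<Rightarrow> 'e set \<Rightarrow> ('e \<Rightarrow> 'v set) \<Rightarrow> bool" where
  "interval_colorable V E ends \<longleftrightarrow> (\<exists>t>0. \<exists>c. interval_coloring V E ends t c)"

definition adjacency :: "'e set \<Rightarrow> ('e \<Rightarrow> 'v set) \<Rightarrow> ('v \<times> 'v) set" where
  "adjacency E ends = {(x, y). \<exists>e\<in>E. ends e = {x, y}}"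

definition connected_graph :: "'v set \<Rightarrow> 'e set \<Rightarrow> ('e \<Rightarrow> 'v set) \<Rightarrow> bool" where
  "connected_graph V E ends \<longleftrightarrow> V \<noteq> {} \<and> (\<forall>u\<in>V. \<forall>v\<in>V. (u, v) \<in> (adjacency E ends)\<^sup>*)"

definition connected_subgraph ::
  "'v set \<Rightarrow> 'e set \<Rightarrow> 'v set \<Rightarrow> 'e set \<Rightarrow> ('e \<Rightarrow> 'v set) \<Rightarrow> bool" where
  "connected_subgraph W F V E ends \<longleftrightarrow>
     W \<subseteq> V \<and> F \<subseteq> E \<and> multigraph W F ends \<and> connected_graph W F ends"

text \<open>\<open>(W, F)\<close> is a component of \<open>(V, E)\<close>: a maximal connected subgraph.\<close>

definition component ::
  "'v set \<Rightarrow> 'e set \<Rightarrow> 'v set \<Rightarrow> 'e set \<Rightarrow> ('e \<Rightarrow> 'v set) \<Rightarrow> bool" where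
  "component W F V E ends \<longleftrightarrow>
     connected_subgraph W F V E ends \<and>
     (\<forall>W' F'. connected_subgraph W' F' V E ends \<and> W \<subseteq> W' \<and> F \<subseteq> F' \<longrightarrow> W' = W \<and> F' = F)"

text \<open>
  The whole graph is a cycle of length \<open>n\<close>, with vertices and edges listed in cyclic order. Two
  parallel edges form a cycle of length 2.
\<close>

definition cycle_graph :: "'v set \<Rightarrow> 'e set \<Rightarrow> ('e \<Rightarrow> 'v set) \<Rightarrow> nat \<Rightarrow> bool" where
  "cycle_graph V E ends n \<longleftrightarrow>
     n \<ge> 2 \<and>
     (\<exists>x y. bij_betw x {..<n} V \<and> bij_betw y {..<n} E \<and>
            (\<forall>i<n. ends (y i) = {x i, x (Suc i mod n)}))"

definition odd_cycle :: "'v set \<Rightarrow> 'e set \<Rightarrow> ('e \<Rightarrow> 'v set) \<Rightarrow> bool" where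
  "odd_cycle V E ends \<longleftrightarrow> (\<exists>n. odd n \<and> cycle_graph V E ends n)"

end

theory Submission imports Defs begin

text \<open>
  Take a proper edge colouring \<open>c\<close> with colours 1, 2, 3. Every vertex of degree 3 sees all three
  colours. Link two edges at a common vertex if the vertex has degree 2, or if it has degree 3 and
  neither of the two edges has colour 3. Each edge is then linked to at most one edge at each end, so
  the linked edges form paths and cycles.

  Suppose first that there is a 2-colouring \<open>\<beta>\<close> of the edges that separates linked edges. Call an
  edge outer if it has colour 3 and an end of degree other than 2. Give the outer edges
  the colours 2 and 5, and the other edges the colours 4 and 3, where in each pair the first is for
  \<open>\<beta>\<close> true. The parity of the new colour is decided by \<open>\<beta>\<close>. At a vertex of degree 2
  the new colours have different parities and at most one of them is outer, so they are consecutive. At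
  a vertex of degree 3 they are 3, 4 and one of 2, 5.

  Such a \<open>\<beta>\<close> fails to exist only because of link cycles of odd length. Such a cycle of links has an
  edge of colour 3, as otherwise \<open>c\<close> itself alternates on it. Both ends of this edge have degree 2,
  because it is linked at both of them. If all vertices on the cycle had degree 2, the cycle would be
  a component of the graph and an odd cycle, which is excluded. So the link cycle contains an edge \<open>h\<close>
  with both ends of degree 2 that is linked to an edge \<open>g\<close> whose other end \<open>v\<close> has degree 3. Let \<open>f\<close> be the
  other edge linked to \<open>g\<close>, at \<open>v\<close>, and let \<open>r\<close> be the third edge at \<open>v\<close>. Cutting the link
  between \<open>f\<close> and \<open>g\<close> leaves a path. Its 2-colouring, in which \<open>f\<close> and \<open>g\<close> agree, can be chosen
  so that \<open>r\<close> differs from them, since \<open>r\<close>, which is not linked at \<open>v\<close>, is not on any link cycle. Along the edges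
  \<open>r\<close>, \<open>f\<close>, \<open>g\<close>, \<open>h\<close> and the edge after \<open>h\<close> the colours 5, 4, 4, 3, 4 (or 2, 3, 3, 4, 3)
  now become 5, 4, 6, 5, 4 (or 2, 3, 1, 2, 3), which repairs \<open>v\<close> and does no harm at the two ends of
  \<open>h\<close>. Hence six colours suffice.

  The combinatorial parts are \<open>two_coloring_acyclic\<close> and \<open>two_coloring_cut_cycle\<close> on
  2-colourings, \<open>two_regular_closed_set_has_cycle\<close> and \<open>component_if_cycle\<close> for the identification of
  cycle components, and \<open>fits_on_mixed\<close> for the repair.
\<close>

section \<open>Two-colourings of graphs of maximum degree two\<close>

text \<open>
  The hypothesis on \<open>X\<close> says that every component of the graph \<open>R\<close> on \<open>S\<close> is a path. It survives the
  removal of a leaf \<open>z\<close>: a set that is closed in the rest but not in \<open>S\<close> contains the neighbour of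
  \<open>z\<close>, and this neighbour has lost one of its at most two neighbours. So leaves can be removed one by
  one, and coloured in the reverse order.
\<close>

lemma two_coloring_if_leaves:
  assumes "finite S" and "sym R" and "irrefl R"
    and "\<forall>x\<in>S. card {y\<in>S. (x, y) \<in> R} \<le> 2"
    and "\<And>X. X \<subseteq> S \<Longrightarrow> X \<noteq> {} \<Longrightarrow> (\<forall>x\<in>X. \<forall>y\<in>S. (x, y) \<in> R \<longrightarrow> y \<in> X) \<Longrightarrow>
           \<exists>x\<in>X. card {y\<in>S. (x, y) \<in> R} \<le> 1"
  shows "\<exists>\<beta> :: 'a \<Rightarrow> bool. \<forall>x\<in>S. \<forall>y\<in>S. (x, y) \<in> R \<longrightarrow> \<beta> x \<noteq> \<beta> y"
  using assms(1,4,5)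
proof (induction "card S" arbitrary: S)
  case 0
  then show ?case by simp
next
  case (Suc n)
  have "S \<noteq> {}" using Suc.hyps(2) by auto
  then obtain z where z: "z \<in> S" "card {y\<in>S. (z, y) \<in> R} \<le> 1"
    using Suc.prems(3)[of S] by blast
  let ?S = "S - {z}"
  have fin: "finite S" by fact
  have mono: "card {y\<in>?S. (x, y) \<in> R} \<le> card {y\<in>S. (x, y) \<in> R}" for x
    using fin by (intro card_mono) auto
  have "\<exists>\<beta> :: 'a \<Rightarrow> bool. \<forall>x\<in>?S. \<forall>y\<in>?S. (x, y) \<in> R \<longrightarrow> \<beta> x \<noteq> \<beta> y"
  proof (rule Suc.hyps(1))
    show "n = card ?S" using Suc.hyps(2) z fin by simp
    show "finite ?S" using fin by simp
    show "\<forall>x\<in>?S. card {y\<in>?S. (x, y) \<in> R} \<le> 2"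
      using Suc.prems(2) by (intro ballI le_trans[OF mono]) simp
    fix X assume X: "X \<subseteq> ?S" "X \<noteq> {}" "\<forall>x\<in>X. \<forall>y\<in>?S. (x, y) \<in> R \<longrightarrow> y \<in> X"
    show "\<exists>x\<in>X. card {y\<in>?S. (x, y) \<in> R} \<le> 1"
    proof (cases "\<exists>x\<in>X. (x, z) \<in> R")
      case True
      then obtain x where x: "x \<in> X" "(x, z) \<in> R" by blast
      have "{y\<in>?S. (x, y) \<in> R} = {y\<in>S. (x, y) \<in> R} - {z}" by auto
      then have "card {y\<in>?S. (x, y) \<in> R} = card {y\<in>S. (x, y) \<in> R} - 1"
        using x z fin by simp
      moreover have "card {y\<in>S. (x, y) \<in> R} \<le> 2" using x X Suc.prems(2) by blast
      ultimately show ?thesis using x by (intro bexI[of _ x]) auto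
    next
      case False
      then have "\<forall>x\<in>X. \<forall>y\<in>S. (x, y) \<in> R \<longrightarrow> y \<in> X" using X by blast
      then obtain x where "x \<in> X" "card {y\<in>S. (x, y) \<in> R} \<le> 1"
        using Suc.prems(3)[of X] X by blast
      then show ?thesis using mono[of x] by (intro bexI[of _ x]) auto
    qed
  qed
  then obtain \<beta> :: "'a \<Rightarrow> bool"
    where \<beta>: "\<forall>x\<in>?S. \<forall>y\<in>?S. (x, y) \<in> R \<longrightarrow> \<beta> x \<noteq> \<beta> y" by (rule exE)
  have "\<exists>b. \<forall>y\<in>S. (z, y) \<in> R \<longrightarrow> \<beta> y \<noteq> b"
  proof (cases "{y\<in>S. (z, y) \<in> R} = {}")
    case False
    then obtain w where "{y\<in>S. (z, y) \<in> R} = {w}"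
    proof -
      have "card {y\<in>S. (z, y) \<in> R} \<noteq> 0" using False fin by simp
      with z(2) have "card {y\<in>S. (z, y) \<in> R} = 1" by linarith
      then show thesis using that by (rule card_1_singletonE)
    qed
    then have "y = w" if "y \<in> S" "(z, y) \<in> R" for y using that by blast
    then show ?thesis by (intro exI[of _ "\<not> \<beta> w"]) blast
  qed auto
  then obtain b where b: "\<forall>y\<in>S. (z, y) \<in> R \<longrightarrow> \<beta> y \<noteq> b" by blast
  have zz: "(z, z) \<notin> R" using \<open>irrefl R\<close> by (auto simp: irrefl_def)
  have sym: "(z, x) \<in> R" if "(x, z) \<in> R" for x using that \<open>sym R\<close> by (meson symD)
  have "(\<beta>(z := b)) x \<noteq> (\<beta>(z := b)) y" if xy: "x \<in> S" "y \<in> S" "(x, y) \<in> R" for x y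
  proof (cases "x = z \<or> y = z")
    case True
    then show ?thesis using zz sym[of x] b xy by auto
  next
    case False
    then show ?thesis using \<beta>[rule_format, of x y] xy by simp
  qed
  then have "\<forall>x\<in>S. \<forall>y\<in>S. (x, y) \<in> R \<longrightarrow> (\<beta>(z := b)) x \<noteq> (\<beta>(z := b)) y"
    by blast
  then show ?case by (rule exI[of _ "\<beta>(z := b)"])
qed

locale bounded_degree_2 =
  fixes S :: "'a set" and R :: "('a \<times> 'a) set"
  assumes finite_S: "finite S"
    and R_subset: "R \<subseteq> S \<times> S"
    and sym_R: "sym R"
    and irrefl_R: "irrefl R"
    and card_nbrs: "card (R `` {x}) \<le> 2"
begin

definition cls :: "'a \<Rightarrow> 'a set" where
  "cls x = R\<^sup>* `` {x}"

definition cyclic :: "'a \<Rightarrow> bool" where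
  "cyclic x \<longleftrightarrow> (\<forall>y\<in>cls x. card (R `` {y}) = 2)"

lemma self_in_cls [simp]: "x \<in> cls x"
  by (simp add: cls_def)

lemma cls_eq: "cls x = cls y" if "y \<in> cls x"
proof -
  have s: "sym (R\<^sup>*)" using sym_R by (rule sym_rtrancl)
  have xy: "(x, y) \<in> R\<^sup>*" using that by (simp add: cls_def)
  then have "(y, x) \<in> R\<^sup>*" using s by (meson symD)
  with xy show ?thesis unfolding cls_def by (auto intro: rtrancl_trans)
qed

lemma R_in_cls: "y \<in> cls x" if "(x, y) \<in> R"
  using that by (auto simp: cls_def)

lemma cls_closed: "z \<in> cls x" if "y \<in> cls x" "(y, z) \<in> R"
  using that by (auto simp: cls_def intro: rtrancl_into_rtrancl)

lemma cyclic_cong: "cyclic x \<longleftrightarrow> cyclic y" if "y \<in> cls x"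
  using cls_eq[OF that] by (simp add: cyclic_def)

lemma cls_least: "cls x \<subseteq> X"
  if "x \<in> X" and "\<And>y z. y \<in> X \<Longrightarrow> y \<in> cls x \<Longrightarrow> (y, z) \<in> R \<Longrightarrow> z \<in> X"
proof
  fix w assume "w \<in> cls x"
  then have "(x, w) \<in> R\<^sup>*" by (simp add: cls_def)
  then show "w \<in> X"
    by (induction rule: rtrancl_induct) (use that in \<open>auto simp: cls_def\<close>)
qed

lemma cls_subset: "cls x \<subseteq> S" if "x \<in> S"
  using cls_least[of x S] that R_subset by auto

lemma finite_nbrs: "finite (R `` {x})"
  by (rule finite_subset[OF _ finite_S]) (use R_subset in auto)

lemma card_nbrs_in: "card {y\<in>T. (x, y) \<in> R} \<le> card (R `` {x})"
  using finite_nbrs by (intro card_mono) auto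

text \<open>
  A class that is not cyclic contains a vertex with at most one neighbour, and so does every nonempty
  closed union of such classes. Since \<open>R\<close> is a relation, two elements that are joined in two ways
  count as neighbours once and form a class that is not cyclic.
\<close>

lemma two_coloring_acyclic:
  "\<exists>\<beta> :: 'a \<Rightarrow> bool. \<forall>x y. (x, y) \<in> R \<and> \<not> cyclic x \<longrightarrow> \<beta> x \<noteq> \<beta> y"
proof -
  let ?S = "{x\<in>S. \<not> cyclic x}"
  have cong: "cyclic x \<longleftrightarrow> cyclic y" if "(x, y) \<in> R" for x y
    using cyclic_cong R_in_cls that by blast
  have "\<exists>\<beta> :: 'a \<Rightarrow> bool. \<forall>x\<in>?S. \<forall>y\<in>?S. (x, y) \<in> R \<longrightarrow> \<beta> x \<noteq> \<beta> y"
  proof (rule two_coloring_if_leaves)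
    show "finite ?S" "sym R" "irrefl R" using finite_S sym_R irrefl_R by auto
    show "\<forall>x\<in>?S. card {y\<in>?S. (x, y) \<in> R} \<le> 2"
      by (intro ballI le_trans[OF card_nbrs_in card_nbrs])
    fix X assume X: "X \<subseteq> ?S" "X \<noteq> {}" "\<forall>x\<in>X. \<forall>y\<in>?S. (x, y) \<in> R \<longrightarrow> y \<in> X"
    then obtain x where x: "x \<in> X" by blast
    with X have "\<not> cyclic x" by blast
    then obtain z where z: "z \<in> cls x" "card (R `` {z}) \<noteq> 2"
      by (auto simp: cyclic_def)
    have "cls x \<subseteq> X"
      proof (rule cls_least[OF x])
      fix y z assume "y \<in> X" "(y, z) \<in> R"
      moreover from this have "z \<in> ?S" using X(1) R_subset cong[of y z] by auto
      ultimately show "z \<in> X" using X(3) by blast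
    qed
    moreover have "card (R `` {z}) \<le> 1" using z card_nbrs[of z] by simp
    then have "card {y\<in>?S. (z, y) \<in> R} \<le> 1"
      by (rule le_trans[OF card_nbrs_in])
    ultimately show "\<exists>x\<in>X. card {y\<in>?S. (x, y) \<in> R} \<le> 1" using z(1) by (intro bexI[of _ z]) auto
  qed
  then obtain \<beta> :: "'a \<Rightarrow> bool"
    where \<beta>: "\<forall>x\<in>?S. \<forall>y\<in>?S. (x, y) \<in> R \<longrightarrow> \<beta> x \<noteq> \<beta> y" by (rule exE)
  have "\<beta> x \<noteq> \<beta> y" if "(x, y) \<in> R" "\<not> cyclic x" for x y
  proof -
    have "x \<in> ?S" "y \<in> ?S" using that R_subset cong[of x y] by auto
    from \<beta>[rule_format, OF this that(1)] show ?thesis .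
  qed
  then show ?thesis by (intro exI[of _ \<beta>] allI impI) (elim conjE)
qed

text \<open>
  After the removal of the edge between \<open>f\<close> and \<open>g\<close> both are leaves, and a nonempty set closed under
  the remaining edges that contained neither of them would be closed under \<open>R\<close>. Exchanging the two
  colours gives \<open>g\<close> any prescribed one.
\<close>

lemma two_coloring_cut_cycle:
  assumes fg: "(f, g) \<in> R"
  shows "\<exists>\<beta> :: 'a \<Rightarrow> bool. \<beta> g = b \<and>
    (\<forall>x y. (x, y) \<in> R \<and> x \<in> cls g \<and> {x, y} \<noteq> {f, g} \<longrightarrow> \<beta> x \<noteq> \<beta> y)"
proof -
  let ?K = "cls g" and ?R = "R - {(f, g), (g, f)}"
  have gf: "(g, f) \<in> R" using fg sym_R by (meson symD)
  have gS: "g \<in> S" using fg R_subset by auto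
  have le: "card {y\<in>?K. (x, y) \<in> ?R} \<le> card (R `` {x})" for x
    using finite_nbrs by (intro card_mono) auto
  have leaf: "card {y\<in>?K. (x, y) \<in> ?R} \<le> 1" if x: "x = f \<or> x = g" for x
  proof -
    obtain w where w: "(x, w) \<in> R" "(x, w) \<notin> ?R" using x
    proof
      assume "x = f"
      then show thesis using fg by (intro that[of g]) auto
    next
      assume "x = g"
      then show thesis using gf by (intro that[of f]) auto
    qed
    have "card {y\<in>?K. (x, y) \<in> ?R} \<le> card (R `` {x} - {w})"
      using finite_nbrs w by (intro card_mono) auto
    also have "\<dots> = card (R `` {x}) - 1" using w by (intro card_Diff_singleton) auto
    finally show ?thesis using card_nbrs[of x] by linarith
  qed
  have "\<exists>\<beta> :: 'a \<Rightarrow> bool. \<forall>x\<in>?K. \<forall>y\<in>?K. (x, y) \<in> ?R \<longrightarrow> \<beta> x \<noteq> \<beta> y"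
  proof (rule two_coloring_if_leaves)
    show "finite ?K" using cls_subset[OF gS] finite_S finite_subset by blast
    show "sym ?R" using sym_R by (auto simp: sym_def)
    show "irrefl ?R" using irrefl_R by (auto simp: irrefl_def)
    show "\<forall>x\<in>?K. card {y\<in>?K. (x, y) \<in> ?R} \<le> 2" by (intro ballI le_trans[OF le card_nbrs])
    fix X assume X: "X \<subseteq> ?K" "X \<noteq> {}" "\<forall>x\<in>X. \<forall>y\<in>?K. (x, y) \<in> ?R \<longrightarrow> y \<in> X"
    have "f \<in> X \<or> g \<in> X"
    proof (rule ccontr)
      assume n: "\<not> (f \<in> X \<or> g \<in> X)"
      obtain x where x: "x \<in> X" using X by blast
      then have eq: "cls g = cls x" using X cls_eq by blast
      have "z \<in> X" if "y \<in> X" "(y, z) \<in> R" for y z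
        using that n X cls_closed[of y g z] by blast
      with x have "cls x \<subseteq> X" by (intro cls_least)
      with eq n show False using self_in_cls by blast
    qed
    then show "\<exists>x\<in>X. card {y\<in>?K. (x, y) \<in> ?R} \<le> 1" using leaf by blast
  qed
  then obtain \<beta> :: "'a \<Rightarrow> bool"
    where \<beta>: "\<forall>x\<in>?K. \<forall>y\<in>?K. (x, y) \<in> ?R \<longrightarrow> \<beta> x \<noteq> \<beta> y" by (rule exE)
  have \<beta>': "\<beta> x \<noteq> \<beta> y" if "(x, y) \<in> R" "x \<in> cls g" "{x, y} \<noteq> {f, g}" for x y
    using that \<beta> cls_closed[of x g y] by auto
  show ?thesis
  proof (cases "\<beta> g = b")
    case True
    show ?thesis by (intro exI[of _ \<beta>] conjI allI impI) (use True \<beta>' in metis)+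
  next
    case False
    show ?thesis
      by (intro exI[of _ "\<lambda>x. \<not> \<beta> x"] conjI allI impI) (use False \<beta>' in metis)+
  qed
qed

end

section \<open>Two-regular components are cycles\<close>

context multigraph
begin

lemma ends_other:
  assumes "e \<in> E" "x \<in> ends e"
  obtains y where "ends e = {x, y}" "x \<noteq> y"
proof -
  have "card (ends e) = 2" using card_ends assms by blast
  then obtain a b where "ends e = {a, b}" "a \<noteq> b" by (meson card_2_iff)
  then show thesis using that assms by (cases "x = a") auto
qed

lemma finite_incident [simp]: "finite (incident_edges E ends v)"
  using finite_E by (simp add: incident_edges_def)

lemma degree_2_edges:
  assumes "degree E ends v = 2" "e \<noteq> f"
    and "e \<in> incident_edges E ends v" "f \<in> incident_edges E ends v"
  shows "incident_edges E ends v = {e, f}"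
proof -
  have "{e, f} = incident_edges E ends v"
    using assms by (intro card_subset_eq) (auto simp: degree_def)
  then show ?thesis by simp
qed

text \<open>
  Follow a walk in \<open>K\<close> that never turns back, up to its first return to a vertex. It cannot return to
  an inner vertex of the walk, since both edges there have been used; so it returns to its start.
\<close>

lemma two_regular_closed_set_has_cycle:
  assumes K: "K \<subseteq> E" "K \<noteq> {}"
    and deg: "\<And>e v. e \<in> K \<Longrightarrow> v \<in> ends e \<Longrightarrow> degree E ends v = 2"
    and closed: "\<And>e v. e \<in> K \<Longrightarrow> v \<in> ends e \<Longrightarrow> incident_edges E ends v \<subseteq> K"
  obtains n x y where "n \<ge> 2" "inj_on x {..<n}" "inj_on y {..<n}" "y ` {..<n} \<subseteq> K"
    and "\<And>i. i < n \<Longrightarrow> ends (y i) = {x i, x (Suc i mod n)}"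
    and "\<And>i. i < n \<Longrightarrow> incident_edges E ends (x (Suc i mod n)) = {y i, y (Suc i mod n)}"
    and "\<And>i. i < n \<Longrightarrow> y (Suc i mod n) \<noteq> y i"
proof -
  let ?P = "\<lambda>(v, e). e \<in> K \<and> v \<in> ends e"
  let ?Q = "\<lambda>(v, e) (v', e'). ends e = {v, v'} \<and> v \<noteq> v' \<and> e \<noteq> e'"
  have "\<exists>s. \<forall>i::nat. ?P (s i) \<and> ?Q (s i) (s (Suc i))"
  proof (rule dependent_nat_choice)
    obtain e where e: "e \<in> K" using K by blast
    then have "card (ends e) = 2" using K card_ends by blast
    then obtain v where "v \<in> ends e" by fastforce
    then show "\<exists>s. ?P s" using e by blast
  next
    fix s :: "'v \<times> 'e" and i :: nat
    assume "?P s"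
    then obtain v e where s: "s = (v, e)" "e \<in> K" "v \<in> ends e" by (cases s) auto
    then obtain v' where v': "ends e = {v, v'}" "v \<noteq> v'" using ends_other K by blast
    have "card (incident_edges E ends v') = 2" using deg[of e v'] s v' by (simp add: degree_def)
    then obtain e' where e': "e' \<in> incident_edges E ends v'" "e' \<noteq> e"
      by (metis card_2_iff insertI1 insertI2)
    then have "e' \<in> K" "v' \<in> ends e'"
      using closed[of e v'] s v' by (auto simp: incident_edges_def)
    then show "\<exists>t. ?P t \<and> ?Q s t" using s v' e' by (intro exI[of _ "(v', e')"]) auto
  qed
  then obtain s where s: "\<And>i::nat. ?P (s i) \<and> ?Q (s i) (s (Suc i))" by blast
  define x y where "x i = fst (s i)" and "y i = snd (s i)" for i
  have yK: "y i \<in> K" and xy: "x i \<in> ends (y i)" and e: "ends (y i) = {x i, x (Suc i)}"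
    and xne: "x i \<noteq> x (Suc i)" and yne: "y i \<noteq> y (Suc i)" for i
    using s[of i] by (auto simp: x_def y_def split: prod.splits)
  have yinc: "y i \<in> incident_edges E ends v" if "v \<in> ends (y i)" for i v
    using yK[of i] K that by (auto simp: incident_edges_def)
  have inc: "incident_edges E ends (x (Suc i)) = {y i, y (Suc i)}" for i
    using deg[OF yK[of i]] yne[of i] yinc e[of i] xy[of "Suc i"]
    by (intro degree_2_edges) auto
  have ex: "\<exists>n. \<exists>j<n. x j = x n"
  proof -
    have "range x \<subseteq> V" using e yK K ends_subset by blast
    then have "\<not> inj x" using finite_V finite_imageD infinite_UNIV_nat finite_subset by blast
    then obtain i j where "x i = x j" "i \<noteq> j" by (auto simp: inj_def)
    then show ?thesis by (metis linorder_neqE_nat)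
  qed
  define n where "n = (LEAST n. \<exists>j<n. x j = x n)"
  have n: "\<exists>j<n. x j = x n" unfolding n_def by (rule LeastI_ex[OF ex])
  have min: "\<not> (\<exists>j<m. x j = x m)" if "m < n" for m
    using not_less_Least that unfolding n_def by blast
  obtain j where j: "j < n" "x j = x n" using n by blast
  have xinj: "x i \<noteq> x k" if "i < n" "k < n" "i \<noteq> k" for i k
    using min that by (metis linorder_neqE_nat)
  have n2: "n \<ge> 2"
  proof (rule ccontr)
    assume "\<not> n \<ge> 2"
    then have "j = 0" "n = 1" using j by auto
    then show False using j xne[of 0] by simp
  qed
  \<comment> \<open>If \<open>j\<close> is positive, then \<open>y (j - 1)\<close> and \<open>y j\<close> are the only edges at \<open>x j\<close>, so the last step
      of the walk goes along one of them. Then \<open>x (n - 1)\<close> is one of \<open>x (j - 1)\<close>, \<open>x j\<close>, \<open>x (j + 1)\<close>; the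
      first two repeat a vertex before \<open>n\<close> or make a loop, the third turns back.\<close>
  have j0: "j = 0"
  proof (rule ccontr)
    assume "j \<noteq> 0"
    then obtain i where i: "j = Suc i" by (cases j) auto
    obtain m where m: "n = Suc m" using j by (cases n) auto
    have "y m \<in> incident_edges E ends (x n)" using yinc e[of m] m by auto
    then have "y m = y i \<or> y m = y j" using inc[of i] i j by auto
    then show False
    proof
      assume "y m = y i"
      then have "x m \<in> {x i, x j}" using e[of m] e[of i] i by auto
      then have "m = i \<or> m = j" using xinj[of m i] xinj[of m j] j i m by auto
      then show False using i m j xne[of m] by auto
    next
      assume yy: "y m = y j"
      then have "{x m, x n} = {x j, x (Suc j)}" using e[of m] e[of j] m by auto
      moreover have "x m \<noteq> x j" using xne[of m] m j by simp
      ultimately have "x m = x (Suc j)" by auto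
      moreover have "m \<noteq> j" using \<open>x m \<noteq> x j\<close> by auto
      ultimately have "m = Suc j" using xinj[of m "Suc j"] j m by auto
      then show False using yy yne[of j] by simp
    qed
  qed
  then have x0: "x n = x 0" using j by simp
  have sn: "Suc i mod n = (if Suc i = n then 0 else Suc i)" if "i < n" for i
    using that by auto
  have xsuc: "x (Suc i mod n) = x (Suc i)" if "i < n" for i
    using sn[OF that] x0 by auto
  have yn: "ends (y i) = {x i, x (Suc i mod n)}" if "i < n" for i
    using e xsuc that by simp
  obtain m where m: "n = Suc m" using n2 by (cases n) auto
  have last: "y m \<noteq> y 0"
  proof
    assume a: "y m = y 0"
    then have "{x m, x n} = {x 0, x 1}" using e[of m] e[of 0] m by simp
    moreover have "x m \<noteq> x 0" using xne[of m] m x0 by auto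
    ultimately have "x m = x 1" by auto
    then have "m = 1" using xinj[of m 1] n2 m by auto
    then show False using a yne[of 0] by simp
  qed
  have ysuc: "y (Suc i mod n) \<noteq> y i" if "i < n" for i
    using sn[OF that] last m yne[of i] by (auto split: if_splits)
  have incn: "incident_edges E ends (x (Suc i mod n)) = {y i, y (Suc i mod n)}" if "i < n" for i
  proof (cases "Suc i = n")
    case False
    then show ?thesis using inc[of i] that by simp
  next
    case True
    then have "i = m" using m by simp
    moreover have "incident_edges E ends (x 0) = {y m, y 0}"
    proof (rule degree_2_edges)
      show "degree E ends (x 0) = 2" using deg[OF yK[of 0]] xy by blast
      show "y m \<noteq> y 0" by (rule last)
      show "y m \<in> incident_edges E ends (x 0)" using yinc e[of m] m x0 by auto
      show "y 0 \<in> incident_edges E ends (x 0)" using yinc xy by auto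
    qed
    ultimately show ?thesis using True by simp
  qed
  have yinj: "y i \<noteq> y k" if "i < k" "k < n" for i k
  proof
    assume a: "y i = y k"
    then have "x k \<in> {x i, x (Suc i)}" using e[of k] e[of i] by auto
    then have "k = Suc i" using xinj[of k i] xinj[of k "Suc i"] that by auto
    then show False using a yne[of i] by simp
  qed
  show thesis
  proof (rule that[of n x y])
    show "inj_on x {..<n}" using xinj by (auto simp: inj_on_def)
    show "inj_on y {..<n}" using yinj by (auto simp: inj_on_def) (metis linorder_neqE_nat)
    show "y ` {..<n} \<subseteq> K" using yK by auto
  qed (fact n2, fact yn, fact incn, fact ysuc)
qed

lemma component_if_closed:
  assumes W: "W \<subseteq> V" "W \<noteq> {}" and F: "F \<subseteq> E" "\<And>e. e \<in> F \<Longrightarrow> ends e \<subseteq> W"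
    and closed: "\<And>v. v \<in> W \<Longrightarrow> incident_edges E ends v \<subseteq> F"
    and conn: "\<And>u v. u \<in> W \<Longrightarrow> v \<in> W \<Longrightarrow> (u, v) \<in> (adjacency F ends)\<^sup>*"
  shows "component W F V E ends"
proof -
  have "multigraph W F ends"
    using W F finite_subset[OF _ finite_V] finite_subset[OF _ finite_E] card_ends
    by (intro multigraph.intro) auto
  then have sub: "connected_subgraph W F V E ends"
    using W F conn by (auto simp: connected_subgraph_def connected_graph_def)
  have "W' = W \<and> F' = F"
    if c: "connected_subgraph W' F' V E ends" and le: "W \<subseteq> W'" "F \<subseteq> F'" for W' F'
  proof -
    have F': "F' \<subseteq> E" "\<And>e. e \<in> F' \<Longrightarrow> ends e \<subseteq> W'" "\<And>e. e \<in> F' \<Longrightarrow> card (ends e) = 2"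
      using c by (auto simp: connected_subgraph_def multigraph_def)
    have stay: "v \<in> W" if "(u, v) \<in> (adjacency F' ends)\<^sup>*" "u \<in> W" for u v
      using that
    proof (induction rule: rtrancl_induct)
      case (step a b)
      then obtain e where e: "e \<in> F'" "ends e = {a, b}" by (auto simp: adjacency_def)
      with step F' have "e \<in> incident_edges E ends a" by (auto simp: incident_edges_def)
      with step closed have "e \<in> F" by blast
      with F e show ?case by auto
    qed
    obtain u where u: "u \<in> W" using W by blast
    have "W' \<subseteq> W"
    proof
      fix v assume "v \<in> W'"
      moreover have "u \<in> W'" using u le by blast
      ultimately have "(u, v) \<in> (adjacency F' ends)\<^sup>*"
        using c unfolding connected_subgraph_def connected_graph_def by simp
      then show "v \<in> W" using u by (rule stay)
    qed
    then have WW: "W' = W" using le by blast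
    have "F' \<subseteq> F"
    proof
      fix e assume e: "e \<in> F'"
      then obtain v where v: "v \<in> ends e" using F'(3)[OF e] by fastforce
      then have "v \<in> W" "e \<in> incident_edges E ends v"
        using e F' WW by (auto simp: incident_edges_def)
      then show "e \<in> F" using closed by blast
    qed
    with WW le show ?thesis by blast
  qed
  with sub show ?thesis by (auto simp: component_def)
qed

text \<open>
  At every vertex of the cycle, the cycle uses all the edges of the graph; this makes it maximal among
  the connected subgraphs.
\<close>

lemma component_if_cycle:
  assumes n: "n \<ge> 2" "inj_on x {..<n}" "inj_on y {..<n}" "y ` {..<n} \<subseteq> E"
    and e: "\<And>i. i < n \<Longrightarrow> ends (y i) = {x i, x (Suc i mod n)}"
    and inc: "\<And>i. i < n \<Longrightarrow> incident_edges E ends (x (Suc i mod n)) = {y i, y (Suc i mod n)}"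
  shows "component (x ` {..<n}) (y ` {..<n}) V E ends"
    and "cycle_graph (x ` {..<n}) (y ` {..<n}) ends n"
proof -
  let ?W = "x ` {..<n}" and ?F = "y ` {..<n}"
  show "cycle_graph ?W ?F ends n"
    unfolding cycle_graph_def
    by (intro conjI exI[of _ x] exI[of _ y]) (use n e in \<open>auto simp: bij_betw_def\<close>)
  have reach: "(x 0, x i) \<in> (adjacency ?F ends)\<^sup>*" if "i < n" for i
    using that
  proof (induction i)
    case (Suc i)
    then have "(x i, x (Suc i)) \<in> adjacency ?F ends"
      using e[of i] by (auto simp: adjacency_def intro!: bexI[of _ i])
    moreover have "(x 0, x i) \<in> (adjacency ?F ends)\<^sup>*" using Suc by simp
    ultimately show ?case by (rule rtrancl_into_rtrancl[rotated])
  qed simp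
  have "sym (adjacency ?F ends)" by (auto simp: sym_def adjacency_def insert_commute)
  then have s: "sym ((adjacency ?F ends)\<^sup>*)" by (rule sym_rtrancl)
  show "component ?W ?F V E ends"
  proof (rule component_if_closed)
    show "?W \<subseteq> V" using e n ends_subset by fastforce
    show "?W \<noteq> {}" using n by (auto simp: lessThan_empty_iff)
    show "?F \<subseteq> E" by fact
    show "ends f \<subseteq> ?W" if "f \<in> ?F" for f using that e by auto
    show "incident_edges E ends v \<subseteq> ?F" if "v \<in> ?W" for v
    proof -
      obtain k where k: "k < n" "v = x k" using \<open>v \<in> ?W\<close> by auto
      define i where "i = (if k = 0 then n - 1 else k - 1)"
      have "i < n" "Suc i mod n = k" using k n by (auto simp: i_def)
      then show ?thesis using inc[of i] k by auto
    qed
    show "(u, v) \<in> (adjacency ?F ends)\<^sup>*" if "u \<in> ?W" "v \<in> ?W" for u v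
    proof -
      have "(x 0, u) \<in> (adjacency ?F ends)\<^sup>*" "(x 0, v) \<in> (adjacency ?F ends)\<^sup>*"
        using that reach by auto
      then show ?thesis using s by (meson rtrancl_trans symD)
    qed
  qed
qed

end

section \<open>The link graph of a 3-edge-colouring\<close>

locale subcubic_3_edge_colored = multigraph V E ends
  for V :: "'v set" and E :: "'e set" and ends :: "'e \<Rightarrow> 'v set" +
  fixes c :: "'e \<Rightarrow> nat"
  assumes proper: "proper_edge_coloring E ends c"
    and colors: "c ` E \<subseteq> {1..3}"
    and degree_le_3: "v \<in> V \<Longrightarrow> degree E ends v \<le> 3"
    and no_odd_cycle: "\<not> (\<exists>W F. component W F V E ends \<and> odd_cycle W F ends)"
begin

abbreviation "inc \<equiv> incident_edges E ends"
abbreviation "deg \<equiv> degree E ends"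

lemma inc_iff: "e \<in> inc x \<longleftrightarrow> e \<in> E \<and> x \<in> ends e"
  by (simp add: incident_edges_def)

lemma c_distinct: "c e \<noteq> c f" if "e \<in> inc x" "f \<in> inc x" "e \<noteq> f"
  using proper that unfolding proper_edge_coloring_def inc_iff by blast

lemma c_cases: "c e = 1 \<or> c e = 2 \<or> c e = 3" if "e \<in> E"
proof -
  have "c e \<in> {1..3}" using colors that by blast
  then show ?thesis by auto
qed

lemma color_3_edge:
  assumes "deg x = 3"
  obtains r where "r \<in> inc x" "c r = 3"
proof -
  have "inj_on c (inc x)" using c_distinct by (auto simp: inj_on_def)
  then have "card (c ` inc x) = 3" using assms by (simp add: card_image degree_def)
  moreover have "c ` inc x \<subseteq> {1..3}" using colors by (auto simp: inc_iff)
  ultimately have "c ` inc x = {1..3}" by (intro card_subset_eq) auto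
  then have "3 \<in> c ` inc x" by simp
  then show thesis using that by auto
qed

definition linked_at :: "'v \<Rightarrow> 'e \<Rightarrow> 'e \<Rightarrow> bool" where
  "linked_at x e f \<longleftrightarrow> e \<noteq> f \<and> e \<in> inc x \<and> f \<in> inc x \<and>
     (deg x = 2 \<or> deg x = 3 \<and> c e \<noteq> 3 \<and> c f \<noteq> 3)"

definition links :: "('e \<times> 'e) set" where
  "links = {(e, f). \<exists>x. linked_at x e f}"

lemma linked_at_sym: "linked_at x e f \<Longrightarrow> linked_at x f e"
  by (auto simp: linked_at_def)

lemma linked_at_unique: "f = g" if f: "linked_at x e f" and g: "linked_at x e g"
proof (cases "deg x = 2")
  case True
  then have "inc x = {e, f}" using f by (intro degree_2_edges) (auto simp: linked_at_def)
  with g show ?thesis by (auto simp: linked_at_def)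
next
  case False
  then have ne: "c e \<noteq> 3" "c f \<noteq> 3" "c g \<noteq> 3" and inc: "e \<in> inc x" "f \<in> inc x" "g \<in> inc x"
    and "e \<noteq> f" "e \<noteq> g"
    using f g by (auto simp: linked_at_def)
  then have "c e \<noteq> c f" "c e \<noteq> c g" using c_distinct by blast+
  with ne have "c f = c g" using c_cases[of e] c_cases[of f] c_cases[of g] inc by (auto simp: inc_iff)
  then show ?thesis using c_distinct inc by blast
qed

lemma card_linked_at: "card {f. linked_at x e f} \<le> 1"
proof -
  have "finite {f. linked_at x e f}"
    by (rule finite_subset[OF _ finite_E]) (auto simp: linked_at_def inc_iff)
  then show ?thesis by (auto simp: card_le_Suc0_iff_eq intro: linked_at_unique)
qed

lemma links_image: "links `` {e} = {f. linked_at x e f} \<union> {f. linked_at y e f}"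
  if "ends e = {x, y}"
  using that by (auto simp: links_def linked_at_def inc_iff)

lemma card_links: "card (links `` {e}) \<le> 2"
proof (cases "e \<in> E")
  case True
  then obtain x y where "ends e = {x, y}" using card_ends by (meson card_2_iff)
  then have "card (links `` {e}) \<le> card {f. linked_at x e f} + card {f. linked_at y e f}"
    by (simp add: links_image card_Un_le)
  then show ?thesis using card_linked_at[of x e] card_linked_at[of y e] by linarith
next
  case False
  then have "links `` {e} = {}" by (auto simp: links_def linked_at_def inc_iff)
  then show ?thesis by simp
qed

sublocale bounded_degree_2 E links
proof
  show "finite E" by (rule finite_E)
  show "links \<subseteq> E \<times> E" by (auto simp: links_def linked_at_def inc_iff)
  show "sym links" by (auto simp: sym_def links_def dest: linked_at_sym)
  show "irrefl links" by (auto simp: irrefl_def links_def linked_at_def)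
  show "card (links `` {e}) \<le> 2" for e by (rule card_links)
qed

lemma linksI: "linked_at x e f \<Longrightarrow> (e, f) \<in> links"
  by (auto simp: links_def)

lemma linked_at_cls: "linked_at x e f \<Longrightarrow> e \<in> cls k \<Longrightarrow> f \<in> cls k"
  using cls_closed linksI by blast

lemma cyclic_linked_at:
  assumes e: "e \<in> E" "cyclic e" "x \<in> ends e"
  obtains f where "linked_at x e f"
proof -
  obtain y where y: "ends e = {y, x}" using ends_other[OF e(1,3)] by (metis insert_commute)
  have "card (links `` {e}) = 2" using e by (simp add: cyclic_def)
  then have "{f. linked_at x e f} \<noteq> {}"
    using links_image[OF y] card_linked_at[of y e] by (metis Un_empty_right numeral_le_one_iff semiring_norm(69))
  then show thesis using that by blast
qed

lemma cyclic_linked_at_distinct: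
  assumes "cyclic e" "ends e = {x, y}" "linked_at x e f" "linked_at y e g"
  shows "f \<noteq> g"
proof
  assume "f = g"
  with assms have "links `` {e} \<subseteq> {f}"
    using links_image[OF assms(2)] linked_at_unique by blast
  then have "card (links `` {e}) \<le> card {f}" by (intro card_mono) auto
  then show False using assms by (simp add: cyclic_def)
qed

lemma cyclic_cls: "cyclic e" if "e \<in> cls k" "cyclic k"
  using cyclic_cong that by blast

section \<open>New colours and the repair of odd link cycles\<close>

definition consecutive :: "nat \<Rightarrow> nat \<Rightarrow> bool" where
  "consecutive p q \<longleftrightarrow> p = Suc q \<or> q = Suc p"

definition consecutive3 :: "nat \<Rightarrow> nat \<Rightarrow> nat \<Rightarrow> bool" where
  "consecutive3 p q r \<longleftrightarrow> (\<exists>a. {p, q, r} = {a, a + 1, a + 2})"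

lemma consecutive3_swap: "consecutive3 p q r \<longleftrightarrow> consecutive3 q p r"
  by (simp add: consecutive3_def insert_commute)

lemma consecutive3I:
  assumes "(p, q) = (a, a + 2) \<or> (p, q) = (a + 2, a)" "r = a + 1"
  shows "consecutive3 p q r"
  unfolding consecutive3_def by (rule exI[of _ a]) (use assms in auto)

lemma consecutive3_outerI:
  assumes "(p, q) = (3, 4) \<or> (p, q) = (4, 3)" "r = 2 \<or> r = 5"
  shows "consecutive3 p q r"
  unfolding consecutive3_def by (rule exI[of _ "if r = 2 then 2 else 3"]) (use assms in auto)

definition plain :: "'e \<Rightarrow> bool" where
  "plain e \<longleftrightarrow> (\<forall>x\<in>ends e. deg x = 2)"

text \<open>
  An edge of colour 3 with both ends of degree 2 may lie on a link cycle. There it has to be treated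
  like the edges of colours 1 and 2, and nothing is lost by treating it so everywhere.
\<close>

definition outer :: "'e \<Rightarrow> bool" where
  "outer e \<longleftrightarrow> c e = 3 \<and> \<not> plain e"

lemma cyclic_not_outer:
  assumes "e \<in> E" "cyclic e"
  shows "\<not> outer e"
proof
  assume o: "outer e"
  then obtain x where x: "x \<in> ends e" "deg x \<noteq> 2" by (auto simp: outer_def plain_def)
  obtain f where "linked_at x e f" using cyclic_linked_at[OF assms x(1)] by blast
  with x o show False by (auto simp: linked_at_def outer_def)
qed

definition base :: "('e \<Rightarrow> bool) \<Rightarrow> 'e \<Rightarrow> nat" where
  "base \<beta> e = (if outer e then if \<beta> e then 2 else 5 else if \<beta> e then 4 else 3)"

text \<open>
  The condition on the new colours \<open>col\<close> at a link. The colour 3 edge \<open>r\<close> at a vertex of degree 3 belongs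
  to a class that is not cyclic and keeps its basic colour, so each class can be coloured
  on its own once the 2-colouring \<open>\<beta>\<close> of the classes that are not cyclic is fixed.
\<close>

definition fits :: "('e \<Rightarrow> nat) \<Rightarrow> ('e \<Rightarrow> bool) \<Rightarrow> 'v \<Rightarrow> 'e \<Rightarrow> 'e \<Rightarrow> bool" where
  "fits col \<beta> x e f \<longleftrightarrow> (deg x = 2 \<longrightarrow> consecutive (col e) (col f)) \<and>
     (deg x = 3 \<longrightarrow> (\<forall>r\<in>inc x. c r = 3 \<longrightarrow> consecutive3 (col e) (col f) (base \<beta> r)))"

lemma fits_sym: "fits col \<beta> x e f \<longleftrightarrow> fits col \<beta> x f e"
  using consecutive3_swap by (auto simp: fits_def consecutive_def)

lemma color_3_outer: "outer r" if "r \<in> inc x" "c r = 3" "deg x = 3"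
  using that by (auto simp: outer_def plain_def inc_iff intro!: bexI[of _ x])

lemma fits_base:
  assumes l: "linked_at x e f" and ne: "\<beta> e \<noteq> \<beta> f" and "col e = base \<beta> e" "col f = base \<beta> f"
  shows "fits col \<beta>' x e f"
proof -
  have "c e \<noteq> c f" using l c_distinct[of e x f] by (auto simp: linked_at_def)
  then have 2: "\<not> (outer e \<and> outer f)" by (auto simp: outer_def)
  have "consecutive (base \<beta> e) (base \<beta> f)"
    using 2 ne by (auto simp: consecutive_def base_def)
  moreover have "consecutive3 (base \<beta> e) (base \<beta> f) (base \<beta>' r)"
    if "deg x = 3" "r \<in> inc x" "c r = 3" for r
  proof (rule consecutive3_outerI)
    have "\<not> outer e" "\<not> outer f" using l that by (auto simp: linked_at_def outer_def)
    then show "(base \<beta> e, base \<beta> f) = (3, 4) \<or> (base \<beta> e, base \<beta> f) = (4, 3)"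
      using ne by (auto simp: base_def)
    show "base \<beta>' r = 2 \<or> base \<beta>' r = 5"
      using color_3_outer[of r x] that by (auto simp: base_def)
  qed
  ultimately show ?thesis using assms by (auto simp: fits_def)
qed

definition fits_on :: "'e set \<Rightarrow> ('e \<Rightarrow> bool) \<Rightarrow> ('e \<Rightarrow> nat) \<Rightarrow> bool" where
  "fits_on K \<beta> col \<longleftrightarrow> col ` K \<subseteq> {1..6} \<and>
     (\<forall>x e f. e \<in> K \<longrightarrow> linked_at x e f \<longrightarrow> fits col \<beta> x e f)"

lemma base_range: "base \<beta> e \<in> {1..6}"
  by (auto simp: base_def)

lemma fits_on_if_two_colorable:
  assumes "\<And>e f. e \<in> K \<Longrightarrow> (e, f) \<in> links \<Longrightarrow> \<beta> e \<noteq> \<beta> f"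
  shows "fits_on K \<beta>' (base \<beta>)"
proof -
  have "fits (base \<beta>) \<beta>' x e f" if "e \<in> K" "linked_at x e f" for x e f
    by (rule fits_base[OF that(2) assms]) (use that linksI in auto)
  then show ?thesis using base_range by (auto simp: fits_on_def)
qed

text \<open>
  An edge of colour 3 in a cyclic class is linked at both ends and therefore plain. So here only the
  colours 1 and 2 occur, and \<open>c\<close> alternates along the links.
\<close>

lemma two_coloring_without_plain:
  assumes k: "k \<in> E" "cyclic k" and no: "\<And>e. e \<in> cls k \<Longrightarrow> \<not> plain e"
  shows "\<exists>\<beta> :: 'e \<Rightarrow> bool. \<forall>e f. e \<in> cls k \<longrightarrow> (e, f) \<in> links \<longrightarrow> \<beta> e \<noteq> \<beta> f"
proof (intro exI allI impI)
  fix e f assume e: "e \<in> cls k" and l: "(e, f) \<in> links"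
  have f: "f \<in> cls k" using cls_closed e l by blast
  have *: "c d = 1 \<or> c d = 2" if "d \<in> cls k" for d
  proof -
    have "d \<in> E" using cls_subset k that by blast
    moreover have "\<not> outer d" using cyclic_not_outer \<open>d \<in> E\<close> cyclic_cls k that by blast
    ultimately show ?thesis using c_cases no that by (auto simp: outer_def)
  qed
  obtain x where "linked_at x e f" using l by (auto simp: links_def)
  then have "c e \<noteq> c f" using c_distinct[of e x f] by (auto simp: linked_at_def)
  then show "(c e = 1) \<noteq> (c f = 1)" using *[OF e] *[OF f] by auto
qed

text \<open>
  All vertices on the class have degree 2, so the class is a cycle and a component of the graph. Its
  length is even by assumption, and the parity of the position is a 2-colouring.
\<close>

lemma two_coloring_all_plain:
  assumes k: "k \<in> E" and plain: "\<And>e. e \<in> cls k \<Longrightarrow> plain e"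
  shows "\<exists>\<beta> :: 'e \<Rightarrow> bool. \<forall>e f. e \<in> cls k \<longrightarrow> (e, f) \<in> links \<longrightarrow> \<beta> e \<noteq> \<beta> f"
proof -
  have K: "cls k \<subseteq> E" "cls k \<noteq> {}" using cls_subset[OF k] self_in_cls by blast+
  have deg: "deg v = 2" if "e \<in> cls k" "v \<in> ends e" for e v
    using plain that by (auto simp: plain_def)
  have closed: "inc v \<subseteq> cls k" if e: "e \<in> cls k" "v \<in> ends e" for e v
  proof
    fix f assume f: "f \<in> inc v"
    have "e \<in> inc v" using K e by (auto simp: inc_iff)
    then have "f = e \<or> linked_at v e f" using f deg e by (auto simp: linked_at_def)
    then show "f \<in> cls k" using e linked_at_cls by blast
  qed
  obtain n x y where n: "n \<ge> 2" "inj_on x {..<n}" "inj_on y {..<n}" "y ` {..<n} \<subseteq> cls k"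
    and e: "\<And>i. i < n \<Longrightarrow> ends (y i) = {x i, x (Suc i mod n)}"
    and inc: "\<And>i. i < n \<Longrightarrow> inc (x (Suc i mod n)) = {y i, y (Suc i mod n)}"
    by (rule two_regular_closed_set_has_cycle[OF K deg closed]) blast+
  have "y ` {..<n} \<subseteq> E" using n K by blast
  note c = component_if_cycle[OF n(1-3) this e inc]
  have even: "even n" using c no_odd_cycle unfolding odd_cycle_def by blast
  have pos: "\<exists>j<n. {d, f} = {y j, y (Suc j mod n)}"
    if i: "i < n" "d = y i" and l: "linked_at v d f" for i d f v
  proof -
    have "v \<in> ends (y i)" using l i by (auto simp: linked_at_def inc_iff)
    then have "\<exists>k<n. v = x k"
      using e[OF i(1)] i(1) by (auto intro: exI[of _ i] exI[of _ "Suc i mod n"])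
    then obtain k where k: "k < n" "v = x k" by blast
    define j where "j = (if k = 0 then n - 1 else k - 1)"
    have j: "j < n" "Suc j mod n = k" using k n by (auto simp: j_def)
    have "d \<noteq> f" "d \<in> inc v" "f \<in> inc v" using l by (auto simp: linked_at_def)
    then show ?thesis using inc[OF j(1)] j k by auto
  qed
  have sub: "cls k \<subseteq> y ` {..<n}"
  proof -
    have "cls (y 0) \<subseteq> y ` {..<n}"
    proof (rule cls_least)
      show "y 0 \<in> y ` {..<n}" using n by auto
      fix d f assume "d \<in> y ` {..<n}" "(d, f) \<in> links"
      then obtain i v where "i < n" "d = y i" "linked_at v d f" by (auto simp: links_def)
      then obtain j where j: "j < n" "{d, f} = {y j, y (Suc j mod n)}" using pos by blast
      moreover have "Suc j mod n < n" using j by simp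
      ultimately show "f \<in> y ` {..<n}" by blast
    qed
    moreover have "y 0 \<in> cls k" using n by auto
    ultimately show ?thesis using cls_eq by blast
  qed
  define \<beta> where "\<beta> d = even (the_inv_into {..<n} y d)" for d
  have \<beta>: "\<beta> (y i) = even i" if "i < n" for i
    using that n by (simp add: \<beta>_def the_inv_into_f_f)
  have "\<beta> d \<noteq> \<beta> f" if d: "d \<in> cls k" and l: "(d, f) \<in> links" for d f
  proof -
    obtain i v where i: "i < n" "d = y i" "linked_at v d f" using d l sub by (auto simp: links_def)
    then obtain j where j: "j < n" "{d, f} = {y j, y (Suc j mod n)}" using pos by blast
    have j': "Suc j mod n < n" using j by simp
    have "even (Suc j mod n) \<noteq> even j" using even j by (cases "Suc j = n") auto
    then have "\<beta> (y j) \<noteq> \<beta> (y (Suc j mod n))" using \<beta>[OF j(1)] \<beta>[OF j'] by simp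
    then show ?thesis using j(2) by (auto simp: doubleton_eq_iff)
  qed
  then show ?thesis by (intro exI[of _ \<beta>] allI impI)
qed

text \<open>
  The repair of a possibly odd link cycle. It needs a vertex \<open>v\<close> of degree 3 from which
  the cycle starts with two vertices of degree 2, joined by \<open>h\<close>.
\<close>

lemma fits_on_mixed:
  assumes k: "k \<in> E" "cyclic k"
    and h: "h \<in> cls k" "plain h" and g: "\<not> plain g" and hg: "(h, g) \<in> links"
  shows "\<exists>col. fits_on (cls k) \<beta>' col"
proof -
  have gk: "g \<in> cls k" using cls_closed h(1) hg by blast
  have KE: "e \<in> E" if "e \<in> cls k" for e using cls_subset[OF k(1)] that by blast
  have cyc: "cyclic e" if "e \<in> cls k" for e using cyclic_cls k that by blast
  obtain u where u: "linked_at u h g" using hg by (auto simp: links_def)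
  have uh: "u \<in> ends h" "u \<in> ends g" using u by (auto simp: linked_at_def inc_iff)
  then have du: "deg u = 2" using h by (auto simp: plain_def)
  obtain v where v: "ends g = {u, v}" "u \<noteq> v" using ends_other KE gk uh by blast
  have dv: "deg v \<noteq> 2" using g du v by (auto simp: plain_def)
  obtain f where f: "linked_at v g f"
    using cyclic_linked_at[OF KE[OF gk] cyc[OF gk], of v] v by blast
  then have dv: "deg v = 3" and fg: "f \<noteq> g" using dv by (auto simp: linked_at_def)
  have fh: "f \<noteq> h"
    using cyclic_linked_at_distinct[OF cyc[OF gk] v(1) linked_at_sym[OF u] f] by blast
  have hg_ne: "h \<noteq> g" using u by (auto simp: linked_at_def)
  obtain r where r: "r \<in> inc v" "c r = 3" using color_3_edge dv by blast
  \<comment> \<open>With this value the colour of \<open>r\<close> is 5 when \<open>f\<close> and \<open>g\<close> get 4 and 6, and 2 when they get 3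
      and 1.\<close>
  define b where "b = (\<not> \<beta>' r)"
  have "(f, g) \<in> links" using f linked_at_sym linksI by blast
  then obtain \<beta> :: "'e \<Rightarrow> bool" where \<beta>g: "\<beta> g = b"
    and \<beta>: "\<And>d e. (d, e) \<in> links \<Longrightarrow> d \<in> cls k \<Longrightarrow> {d, e} \<noteq> {f, g} \<Longrightarrow> \<beta> d \<noteq> \<beta> e"
    using two_coloring_cut_cycle[of f g b] cls_eq[OF gk] by metis
  show ?thesis
  proof (cases "\<beta> f = \<beta> g")
    case False
    have "\<beta> d \<noteq> \<beta> e" if "d \<in> cls k" "(d, e) \<in> links" for d e
      using \<beta>[of d e] that False by (cases "{d, e} = {f, g}") (auto simp: doubleton_eq_iff)
    then have "fits_on (cls k) \<beta>' (base \<beta>)" by (rule fits_on_if_two_colorable)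
    then show ?thesis by blast
  next
    case True
    then have \<beta>f: "\<beta> f = b" using \<beta>g by simp
    have \<beta>h: "\<beta> h = (\<not> b)"
      using \<beta>[OF hg h(1)] fh hg_ne \<beta>g by (auto simp: doubleton_eq_iff)
    define col where
      "col = (base \<beta>)(g := if b then 6 else 1, h := if b then 5 else 2)"
    have colg: "col g = (if b then 6 else 1)" and colh: "col h = (if b then 5 else 2)"
      and col: "\<And>e. e \<noteq> g \<Longrightarrow> e \<noteq> h \<Longrightarrow> col e = base \<beta> e"
      using hg_ne by (auto simp: col_def)
    have inner: "col e = (if \<beta> e then 4 else 3)" if "e \<in> cls k" "e \<noteq> g" "e \<noteq> h" for e
      using col[OF that(2,3)] cyclic_not_outer[OF KE cyc] that by (simp add: base_def)
    have at_g: "fits col \<beta>' x g q" if l: "linked_at x g q" for x q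
    proof -
      have "x = u \<or> x = v" using l v by (auto simp: linked_at_def inc_iff)
      then show ?thesis
      proof
        assume x: "x = u"
        then have "q = h" using l u linked_at_sym linked_at_unique by blast
        then show ?thesis using x du colg colh by (auto simp: fits_def consecutive_def)
      next
        assume x: "x = v"
        then have q: "q = f" using l f linked_at_unique by blast
        have "f \<in> cls k" using f gk linked_at_cls by blast
        then have cf: "col f = (if b then 4 else 3)" using inner fg fh \<beta>f by simp
        have "consecutive3 (col g) (col f) (base \<beta>' r')" if "r' \<in> inc v" "c r' = 3" for r'
        proof -
          have "r' = r" using c_distinct[of r' v r] r that by auto
          moreover have "base \<beta>' r = (if b then 5 else 2)"
            using color_3_outer[OF r dv] by (simp add: base_def b_def)
          ultimately show ?thesis using cf colg
            by (intro consecutive3I[where a = "if b then 4 else 1"]) auto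
        qed
        then show ?thesis using x q dv by (auto simp: fits_def)
      qed
    qed
    have at_h: "fits col \<beta>' x h q" if l: "linked_at x h q" and q: "q \<noteq> g" for x q
    proof -
      have x: "deg x = 2" using l h by (auto simp: linked_at_def inc_iff plain_def)
      have qk: "q \<in> cls k" "q \<noteq> h" using l h linked_at_cls by (auto simp: linked_at_def)
      have "\<beta> h \<noteq> \<beta> q" using \<beta>[OF linksI[OF l] h(1)] q hg_ne by (auto simp: doubleton_eq_iff)
      then have "col q = (if b then 4 else 3)" using inner[OF qk(1) q qk(2)] \<beta>h by auto
      then show ?thesis using x colh by (auto simp: fits_def consecutive_def)
    qed
    have "fits col \<beta>' x p q" if p: "p \<in> cls k" and l: "linked_at x p q" for x p q
    proof -
      have l': "linked_at x q p" using l by (rule linked_at_sym)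
      consider "p = g" | "q = g" | "p = h" "q \<noteq> g" | "q = h" "p \<noteq> g"
        | "p \<notin> {g, h}" "q \<notin> {g, h}" by blast
      then show ?thesis
      proof cases
        case 1 with at_g l show ?thesis by blast
      next
        case 2 with at_g l' fits_sym show ?thesis by blast
      next
        case 3 with at_h l show ?thesis by blast
      next
        case 4 with at_h l' fits_sym show ?thesis by blast
      next
        case 5
        then have "\<beta> p \<noteq> \<beta> q" using \<beta>[OF linksI[OF l] p] by (auto simp: doubleton_eq_iff)
        then show ?thesis using 5 col l by (intro fits_base) auto
      qed
    qed
    moreover have "col e \<in> {1..6}" for e
      using base_range[of \<beta> e] colg colh col[of e] by (cases "e = g \<or> e = h") auto
    ultimately have "fits_on (cls k) \<beta>' col" by (auto simp: fits_on_def)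
    then show ?thesis by blast
  qed
qed

text \<open>
  Since a class is connected by links, either it contains a link from a plain edge to one that is not
  plain, or its edges are all plain, or none of them is.
\<close>

lemma ex_fits_on_cyclic:
  assumes k: "k \<in> E" "cyclic k"
  shows "\<exists>col. fits_on (cls k) \<beta>' col"
proof -
  have 2: ?thesis
    if "\<exists>\<beta> :: 'e \<Rightarrow> bool. \<forall>e f. e \<in> cls k \<longrightarrow> (e, f) \<in> links \<longrightarrow> \<beta> e \<noteq> \<beta> f"
  proof -
    from that obtain \<beta> :: "'e \<Rightarrow> bool"
      where "\<forall>e f. e \<in> cls k \<longrightarrow> (e, f) \<in> links \<longrightarrow> \<beta> e \<noteq> \<beta> f" by (rule exE)
    then have "fits_on (cls k) \<beta>' (base \<beta>)" by (intro fits_on_if_two_colorable) simp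
    then show ?thesis by blast
  qed
  show ?thesis
  proof (cases "\<exists>h g. h \<in> cls k \<and> plain h \<and> \<not> plain g \<and> (h, g) \<in> links")
    case True
    then show ?thesis using fits_on_mixed[OF k] by blast
  next
    case False
    show ?thesis
    proof (cases "\<exists>e\<in>cls k. plain e")
      case True
      then obtain e where e: "e \<in> cls k" "plain e" by blast
      have "cls e \<subseteq> {d. plain d}"
        using e False cls_eq[OF e(1)] by (intro cls_least) auto
      then show ?thesis using cls_eq[OF e(1)] by (intro 2 two_coloring_all_plain[OF k(1)]) auto
    next
      case False
      then show ?thesis by (intro 2 two_coloring_without_plain[OF k]) auto
    qed
  qed
qed

lemma interval_coloring_6: "\<exists>col. interval_coloring V E ends 6 col"
proof -
  obtain \<beta> :: "'e \<Rightarrow> bool"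
    where \<beta>: "\<forall>x y. (x, y) \<in> links \<and> \<not> cyclic x \<longrightarrow> \<beta> x \<noteq> \<beta> y"
    using two_coloring_acyclic by (rule exE)
  define colK where "colK K = (SOME col. fits_on K \<beta> col)" for K
  have colK: "fits_on (cls k) \<beta> (colK (cls k))" if "k \<in> E" "cyclic k" for k
    unfolding colK_def using ex_fits_on_cyclic[OF that] by (rule someI_ex)
  define col where "col e = (if cyclic e then colK (cls e) e else base \<beta> e)" for e
  have range: "col e \<in> {1..6}" if "e \<in> E" for e
  proof (cases "cyclic e")
    case True
    then have "colK (cls e) ` cls e \<subseteq> {1..6}" using colK[OF that] by (simp add: fits_on_def)
    then have "colK (cls e) e \<in> {1..6}" using self_in_cls[of e] by blast
    with True show ?thesis by (simp add: col_def)
  next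
    case False
    then show ?thesis using base_range[of \<beta> e] by (simp add: col_def)
  qed
  have fits: "fits col \<beta> x e f" if l: "linked_at x e f" for x e f
  proof (cases "cyclic e")
    case True
    have f: "f \<in> cls e" using l linked_at_cls by auto
    then have "cyclic f" "cls f = cls e" using True cyclic_cls cls_eq by blast+
    then have "col e = colK (cls e) e" "col f = colK (cls e) f" using True by (auto simp: col_def)
    moreover have "fits (colK (cls e)) \<beta> x e f"
      using colK[OF _ True] l by (auto simp: fits_on_def linked_at_def inc_iff)
    ultimately show ?thesis by (simp add: fits_def)
  next
    case False
    moreover have "e \<in> cls f" using R_in_cls linksI linked_at_sym l by blast
    ultimately have "\<not> cyclic f" using cyclic_cls by blast
    with False show ?thesis using \<beta> l linksI by (intro fits_base[of x e f \<beta>]) (auto simp: col_def)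
  qed
  have vertex: "inj_on col (inc x) \<and> (\<exists>a b. col ` inc x = {a..b})" if x: "x \<in> V" for x
  proof -
    have "card (inc x) \<le> 3" using degree_le_3[OF x] by (simp add: degree_def)
    then consider "card (inc x) = 0" | "card (inc x) = 1" | "card (inc x) = 2" | "card (inc x) = 3"
      by linarith
    then show ?thesis
    proof cases
      case 1
      then have "inc x = {}" by simp
      then have "inj_on col (inc x)" "col ` inc x = {1..0}" by simp_all
      then show ?thesis by blast
    next
      case 2
      then obtain e where "inc x = {e}" by (rule card_1_singletonE)
      then have "inj_on col (inc x)" "col ` inc x = {col e..col e}" by simp_all
      then show ?thesis by blast
    next
      case 3
      then obtain e f where ef: "inc x = {e, f}" "e \<noteq> f" by (meson card_2_iff)
      have "deg x = 2" using 3 by (simp add: degree_def)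
      then have "fits col \<beta> x e f" using ef by (intro fits) (auto simp: linked_at_def)
      then have "consecutive (col e) (col f)" using \<open>deg x = 2\<close> by (simp add: fits_def)
      then have "inj_on col (inc x)" "col ` inc x = {min (col e) (col f)..max (col e) (col f)}"
        using ef by (auto simp: consecutive_def)
      then show ?thesis by blast
    next
      case 4
      then have d: "deg x = 3" by (simp add: degree_def)
      obtain r where r: "r \<in> inc x" "c r = 3" using color_3_edge d by blast
      have "card (inc x - {r}) = 2" using 4 r by simp
      then obtain e f where ef: "inc x - {r} = {e, f}" "e \<noteq> f" by (meson card_2_iff)
      then have inc: "inc x = {e, f, r}" "e \<noteq> r" "f \<noteq> r" using r by auto
      then have "c e \<noteq> 3" "c f \<noteq> 3" using c_distinct[of e x r] c_distinct[of f x r] r by auto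
      then have "fits col \<beta> x e f" using inc ef d by (intro fits) (auto simp: linked_at_def)
      then have "consecutive3 (col e) (col f) (base \<beta> r)" using d r by (auto simp: fits_def)
      moreover have "col r = base \<beta> r"
        using color_3_outer[OF r d] cyclic_not_outer[of r] r by (auto simp: col_def inc_iff)
      ultimately obtain a where a: "col ` inc x = {a, a + 1, a + 2}"
        using inc by (auto simp: consecutive3_def)
      have "card (col ` inc x) = 3" unfolding a by simp
      then have "inj_on col (inc x)" using 4 by (intro eq_card_imp_inj_on) auto
      moreover have "col ` inc x = {a..a + 2}" unfolding a by auto
      ultimately show ?thesis by blast
    qed
  qed
  have "col e \<noteq> col f" if ef: "e \<in> E" "f \<in> E" "e \<noteq> f" "ends e \<inter> ends f \<noteq> {}" for e f
  proof -
    obtain x where x: "x \<in> ends e" "x \<in> ends f" using ef by blast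
    then have "x \<in> V" using ends_subset ef by blast
    then have "inj_on col (inc x)" using vertex by blast
    then show ?thesis using x ef by (auto simp: inj_on_def inc_iff)
  qed
  then have "proper_edge_coloring E ends col" by (auto simp: proper_edge_coloring_def)
  moreover have "col ` E \<subseteq> {1..6}" using range by blast
  ultimately have "interval_coloring V E ends 6 col"
    using vertex by (simp add: interval_coloring_def)
  then show ?thesis by blast
qed

end

lemma ex_coloring_chromatic_index:
  assumes "finite E"
  shows "\<exists>c. proper_edge_coloring E ends c \<and> c ` E \<subseteq> {1..chromatic_index E ends}"
proof -
  obtain i :: "'a \<Rightarrow> nat" where i: "inj_on i E" "i ` E = {0..<card E}"
    using ex_bij_betw_finite_nat[OF assms] by (auto simp: bij_betw_def)
  have "proper_edge_coloring E ends (Suc \<circ> i) \<and> (Suc \<circ> i) ` E \<subseteq> {1..card E}"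
    using i by (fastforce simp: proper_edge_coloring_def inj_on_def)
  then have "\<exists>k c. proper_edge_coloring E ends c \<and> c ` E \<subseteq> {1..k}" by blast
  then show ?thesis unfolding chromatic_index_def by (rule LeastI_ex)
qed

theorem theorem2p1:
  fixes V :: "'v set" and E :: "'e set" and ends :: "'e \<Rightarrow> 'v set"
  assumes "multigraph V E ends"
    and "chromatic_index E ends = max_degree V E ends"
    and "max_degree V E ends \<le> 3"
    and "\<not> (\<exists>W F. component W F V E ends \<and> odd_cycle W F ends)"
  shows "interval_colorable V E ends"
proof -
  interpret multigraph V E ends by fact
  obtain c where c: "proper_edge_coloring E ends c" "c ` E \<subseteq> {1..chromatic_index E ends}"
    using ex_coloring_chromatic_index[OF finite_E] by blast
  interpret subcubic_3_edge_colored V E ends c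
  proof
    show "proper_edge_coloring E ends c" by fact
    show "c ` E \<subseteq> {1..3}" using c(2) assms(2,3) by fastforce
    show "degree E ends v \<le> 3" if "v \<in> V" for v
    proof -
      have "degree E ends v \<le> max_degree V E ends"
        unfolding max_degree_def using finite_V that by (intro Max_ge) auto
      then show ?thesis using assms(3) by simp
    qed
    show "\<not> (\<exists>W F. component W F V E ends \<and> odd_cycle W F ends)" by fact
  qed
  show ?thesis
    unfolding interval_colorable_def using interval_coloring_6 by (intro exI[of _ 6]) simp
qed

end
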